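(* For all $h,h'\in\omega^\omega$ going to infinity, $\min\{\mathfrak{b}^{\mathrm{LLc}}_{b,h}:b\in\omega^\omega\}=\min\{\mathfrak{b}^{\mathrm{LLc}}_{b,h'}:b\in\omega^\omega\}$ and $\sup\{\mathfrak{d}^{\mathrm{LLc}}_{b,h}:b\in\omega^\omega\}=\sup\{\mathfrak{d}^{\mathrm{LLc}}_{b,h'}:b\in\omega^\omega\}$.
   Context: For $b,h\in\omega^\omega$ (always with the convention $1\leq h(n)<b(n)$ for all $n$, so minima/suprema range over $b$ with $b>h$ pointwise): $\prod b=\prod_n b(n)$, $\mathcal{S}(b,h)=\prod_n[b(n)]^{\leq h(n)}$. For $x\in\prod b$, $\varphi\in\mathcal{S}(b,h)$, $D\in[\omega]^\omega$, $x\in^*_D\varphi$ iff $x(n)\in\varphi(n)$ for all but finitely many $n\in D$. $\mathfrak{b}^{\mathrm{LLc}}_{b,h}$ is the least size of $F\subseteq\prod b$ such that no pair $(D,\varphi)\in[\omega]^\omega\times\mathcal{S}(b,h)$ satisfies $x\in^*_D\varphi$ for all $x\in F$; $\mathfrak{d}^{\mathrm{LLc}}_{b,h}$ is the least size of a family $\Phi\subseteq[\omega]^\omega\times\mathcal{S}(b,h)$ such that every $x\in\prod b$ satisfies $x\in^*_D\varphi$ for some $(D,\varphi)\in\Phi$. *)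

theory Defs
  imports Complex_Main "HOL-Library.FuncSet"
begin

unbundle cardinal_syntax

text \<open>Cardinals are cardinal orders on a type and are compared up to \<open>=o\<close>. The next two
  operators pick a representative of the minimum and of the supremum of a set of cardinal orders
  on one type. The existence and minimality lemmas below show that the choice is always possible
  (for a nonempty set in the case of the minimum), and that the supremum is the least
  one even among cardinals living on other types.\<close>

definition card_min :: "'a rel set \<Rightarrow> 'a rel" where
  "card_min R = (SOME r. r \<in> R \<and> (\<forall>s\<in>R. r \<le>o s))"

definition card_sup :: "'a rel set \<Rightarrow> 'a rel" where
  "card_sup R = card_min {r. Card_order r \<and> (\<forall>s\<in>R. s \<le>o r)}"

lemma card_min:
  assumes "R \<noteq> {}" "\<forall>r\<in>R. Card_order r"
  shows "card_min R \<in> R" and "s \<in> R \<Longrightarrow> card_min R \<le>o s"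
proof -
  have "\<exists>r. r \<in> R \<and> (\<forall>s\<in>R. r \<le>o s)"
    using exists_minim_Card_order[OF assms] by blast
  from someI_ex[OF this] show "card_min R \<in> R" "s \<in> R \<Longrightarrow> card_min R \<le>o s"
    unfolding card_min_def by blast+
qed

lemma card_sup:
  fixes R :: "'a rel set" and k :: "'b rel"
  assumes R: "\<forall>r\<in>R. Card_order r"
  shows "Card_order (card_sup R)"
    and "s \<in> R \<Longrightarrow> s \<le>o card_sup R"
    and "Card_order k \<Longrightarrow> \<forall>s\<in>R. s \<le>o k \<Longrightarrow> card_sup R \<le>o k"
proof -
  let ?U = "{r :: 'a rel. Card_order r \<and> (\<forall>s\<in>R. s \<le>o r)}"
  have bnd: "s \<le>o |UNIV :: 'a set|" if "s \<in> R" for s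
  proof -
    have "s =o |Field s|"
      using R that by (intro ordIso_symmetric[OF card_of_Field_ordIso]) blast
    then show ?thesis
      by (rule ordIso_ordLeq_trans) (rule card_of_mono1[OF subset_UNIV])
  qed
  then have U: "|UNIV :: 'a set| \<in> ?U"
    by (auto intro: card_of_Card_order)
  then have ne: "?U \<noteq> {}" by blast
  have co: "\<forall>r\<in>?U. Card_order r" by blast
  note m = card_min[OF ne co, folded card_sup_def]
  show "Card_order (card_sup R)" using m(1) by blast
  show "s \<in> R \<Longrightarrow> s \<le>o card_sup R" using m(1) by blast
  assume k: "Card_order k" and ub: "\<forall>s\<in>R. s \<le>o k"
  have "k \<le>o |UNIV :: 'a set| \<or> |UNIV :: 'a set| \<le>o k"
    using k by (intro ordLeq_total card_of_Well_order) (simp add: card_order_on_def)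
  then show "card_sup R \<le>o k"
  proof
    assume "|UNIV :: 'a set| \<le>o k"
    with m(2)[OF U] show ?thesis by (rule ordLeq_transitive)
  next
    assume "k \<le>o |UNIV :: 'a set|"
    then obtain p :: "'a rel" where p: "k =o p"
      unfolding internalize_ordLeq[of k] by blast
    have "Card_order p" using Card_order_ordIso2[OF k p] .
    moreover have "\<forall>s\<in>R. s \<le>o p" using ub ordLeq_ordIso_trans[OF _ p] by blast
    ultimately have "card_sup R \<le>o p" using m(2) by blast
    then show ?thesis by (rule ordLeq_ordIso_trans) (rule ordIso_symmetric[OF p])
  qed
qed

definition seqs :: "(nat \<Rightarrow> nat) \<Rightarrow> (nat \<Rightarrow> nat) set" where
  "seqs b = (\<Pi> n\<in>UNIV. {..<b n})"

definition slaloms :: "(nat \<Rightarrow> nat) \<Rightarrow> (nat \<Rightarrow> nat) \<Rightarrow> (nat \<Rightarrow> nat set) set" where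
  "slaloms b h = (\<Pi> n\<in>UNIV. {A. A \<subseteq> {..<b n} \<and> card A \<le> h n})"

definition localized_on :: "nat set \<Rightarrow> (nat \<Rightarrow> nat) \<Rightarrow> (nat \<Rightarrow> nat set) \<Rightarrow> bool" where
  "localized_on D x \<phi> \<longleftrightarrow> finite {n \<in> D. x n \<notin> \<phi> n}"

definition b_LLc :: "(nat \<Rightarrow> nat) \<Rightarrow> (nat \<Rightarrow> nat) \<Rightarrow> (nat \<Rightarrow> nat) rel" where
  "b_LLc b h = card_min {|F| | F. F \<subseteq> seqs b \<and>
     \<not> (\<exists>(D, \<phi>) \<in> {D. infinite D} \<times> slaloms b h. \<forall>x\<in>F. localized_on D x \<phi>)}"

definition d_LLc :: "(nat \<Rightarrow> nat) \<Rightarrow> (nat \<Rightarrow> nat) \<Rightarrow> (nat set \<times> (nat \<Rightarrow> nat set)) rel" where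
  "d_LLc b h = card_min {|\<Phi>| | \<Phi>. \<Phi> \<subseteq> {D. infinite D} \<times> slaloms b h \<and>
     (\<forall>x\<in>seqs b. \<exists>(D, \<phi>) \<in> \<Phi>. localized_on D x \<phi>)}"

text \<open>The minima defining the two cardinals are taken over nonempty sets.\<close>

lemma b_LLc_nonempty:
  assumes "\<forall>n. h n < b n"
  shows "\<not> (\<exists>(D, \<phi>) \<in> {D. infinite D} \<times> slaloms b h. \<forall>x\<in>seqs b. localized_on D x \<phi>)"
proof clarify
  fix D \<phi> assume D: "infinite D" and \<phi>: "\<phi> \<in> slaloms b h"
    and loc: "\<forall>x\<in>seqs b. localized_on D x \<phi>"
  have "\<exists>k<b n. k \<notin> \<phi> n" for n
  proof (rule ccontr)
    assume "\<not> ?thesis"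
    with \<phi> have "\<phi> n = {..<b n}" and "card (\<phi> n) \<le> h n" unfolding slaloms_def by auto
    with spec[OF assms, of n] show False by simp
  qed
  then obtain x where x: "\<And>n. x n < b n" "\<And>n. x n \<notin> \<phi> n" by metis
  then have "finite {n \<in> D. x n \<notin> \<phi> n}"
    using loc unfolding localized_on_def seqs_def by blast
  with x D show False by simp
qed

lemma d_LLc_nonempty:
  assumes "\<forall>n. 1 \<le> h n" and "x \<in> seqs b"
  shows "\<exists>(D, \<phi>) \<in> {D. infinite D} \<times> slaloms b h. localized_on D x \<phi>"
  using assms
  by (intro bexI[of _ "(UNIV, \<lambda>n. {x n})"]) (auto simp: localized_on_def slaloms_def seqs_def)

end

theory Submission
  imports Defs
begin

text \<open>Since \<open>D\<close> may be any infinite set, localization can be transferred along subsequences: given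
  \<open>b > h\<close>, pick a strictly increasing \<open>a\<close> with \<open>h'(n) \<le> h(a(n))\<close>, so that \<open>b \<circ> a > h'\<close>.
  If \<open>x \<circ> a\<close> is localized on \<open>D\<close> by an \<open>h'\<close>-slalom \<open>\<phi>\<close>, then \<open>x\<close> is localized on \<open>a[D]\<close> by the
  \<open>h\<close>-slalom that copies \<open>\<phi>(n)\<close> to position \<open>a(n)\<close>. This Tukey connection gives
  \<open>b_LLc (b \<circ> a) h' \<le>o b_LLc b h\<close> and \<open>d_LLc b h \<le>o d_LLc (b \<circ> a) h'\<close>; then exchange \<open>h\<close> and
  \<open>h'\<close>.\<close>

lemma Card_order_card_min:
  assumes "R \<noteq> {}" "\<forall>r\<in>R. Card_order r"
  shows "Card_order (card_min R)"
  using card_min(1)[OF assms] assms(2) by blast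

lemma card_min_mono:
  assumes "R \<noteq> {}" "\<forall>r\<in>R. Card_order r" "\<forall>s\<in>S. Card_order s"
    and le: "\<forall>r\<in>R. \<exists>s\<in>S. s \<le>o r"
  shows "card_min S \<le>o card_min R"
proof -
  have "card_min R \<in> R" using assms(1,2) by (rule card_min(1))
  with le obtain s where s: "s \<in> S" "s \<le>o card_min R" by blast
  then have "card_min S \<le>o s" using assms(3) by (intro card_min(2)) auto
  then show ?thesis using s(2) by (rule ordLeq_transitive)
qed

lemma card_sup_mono:
  assumes R: "\<forall>r\<in>R. Card_order r" and S: "\<forall>s\<in>S. Card_order s"
    and le: "\<forall>r\<in>R. \<exists>s\<in>S. r \<le>o s"
  shows "card_sup R \<le>o card_sup S"
proof (rule card_sup(3)[OF R card_sup(1)[OF S]])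
  show "\<forall>r\<in>R. r \<le>o card_sup S"
    using le card_sup(2)[OF S] ordLeq_transitive by blast
qed

record ('a, 'b) relational_system =
  challenges :: "'a set"
  responses :: "'b set"
  met_by :: "'a \<Rightarrow> 'b \<Rightarrow> bool"

definition unbounded :: "('a, 'b) relational_system \<Rightarrow> 'a set \<Rightarrow> bool" where
  "unbounded S F \<longleftrightarrow> F \<subseteq> challenges S \<and> \<not> (\<exists>y\<in>responses S. \<forall>x\<in>F. met_by S x y)"

definition dominating :: "('a, 'b) relational_system \<Rightarrow> 'b set \<Rightarrow> bool" where
  "dominating S G \<longleftrightarrow> G \<subseteq> responses S \<and> (\<forall>x\<in>challenges S. \<exists>y\<in>G. met_by S x y)"

definition bounding_number :: "('a, 'b) relational_system \<Rightarrow> 'a rel" where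
  "bounding_number S = card_min {|F| | F. unbounded S F}"

definition dominating_number :: "('a, 'b) relational_system \<Rightarrow> 'b rel" where
  "dominating_number S = card_min {|G| | G. dominating S G}"

definition tukey_connection ::
  "('a, 'b) relational_system \<Rightarrow> ('c, 'd) relational_system \<Rightarrow> ('a \<Rightarrow> 'c) \<Rightarrow> ('d \<Rightarrow> 'b) \<Rightarrow> bool" where
  "tukey_connection S T f g \<longleftrightarrow>
     f \<in> challenges S \<rightarrow> challenges T \<and> g \<in> responses T \<rightarrow> responses S \<and>
     (\<forall>x\<in>challenges S. \<forall>y\<in>responses T. met_by T (f x) y \<longrightarrow> met_by S x (g y))"

lemma Card_order_bounding_number: "unbounded S F \<Longrightarrow> Card_order (bounding_number S)"
  unfolding bounding_number_def
  by (rule Card_order_card_min) (auto simp: card_of_Card_order)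

lemma Card_order_dominating_number: "dominating S G \<Longrightarrow> Card_order (dominating_number S)"
  unfolding dominating_number_def
  by (rule Card_order_card_min) (auto simp: card_of_Card_order)

lemma unbounded_tukey_image:
  assumes "tukey_connection S T f g" "unbounded S F"
  shows "unbounded T (f ` F)"
  using assms unfolding tukey_connection_def unbounded_def by blast

lemma dominating_tukey_image:
  assumes "tukey_connection S T f g" "dominating T G"
  shows "dominating S (g ` G)"
  unfolding dominating_def
proof (intro conjI ballI)
  show "g ` G \<subseteq> responses S"
    using assms unfolding tukey_connection_def dominating_def by blast
next
  fix x assume x: "x \<in> challenges S"
  then have "f x \<in> challenges T"
    using assms(1) unfolding tukey_connection_def by blast
  then obtain y where "y \<in> G" "y \<in> responses T" "met_by T (f x) y"
    using assms(2) unfolding dominating_def by blast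
  with x show "\<exists>z\<in>g ` G. met_by S x z"
    using assms(1) unfolding tukey_connection_def by blast
qed

lemma tukey_bounding_number_le:
  assumes tukey: "tukey_connection S T f g" and "unbounded S F"
  shows "bounding_number T \<le>o bounding_number S"
  unfolding bounding_number_def
proof (rule card_min_mono)
  show "{|F| | F. unbounded S F} \<noteq> {}" using assms(2) by blast
  show "\<forall>r\<in>{|F| | F. unbounded S F}. \<exists>s\<in>{|F| | F. unbounded T F}. s \<le>o r"
    using unbounded_tukey_image[OF tukey] card_of_image by blast
qed (auto simp: card_of_Card_order)

lemma tukey_dominating_number_le:
  assumes tukey: "tukey_connection S T f g" and "dominating T G"
  shows "dominating_number S \<le>o dominating_number T"
  unfolding dominating_number_def
proof (rule card_min_mono)
  show "{|G| | G. dominating T G} \<noteq> {}" using assms(2) by blast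
  show "\<forall>r\<in>{|G| | G. dominating T G}. \<exists>s\<in>{|G| | G. dominating S G}. s \<le>o r"
    using dominating_tukey_image[OF tukey] card_of_image by blast
qed (auto simp: card_of_Card_order)

definition LLc ::
  "(nat \<Rightarrow> nat) \<Rightarrow> (nat \<Rightarrow> nat) \<Rightarrow> (nat \<Rightarrow> nat, nat set \<times> (nat \<Rightarrow> nat set)) relational_system" where
  "LLc b h = \<lparr>challenges = seqs b, responses = {D. infinite D} \<times> slaloms b h,
     met_by = (\<lambda>x (D, \<phi>). localized_on D x \<phi>)\<rparr>"

lemma b_LLc_eq_bounding_number: "b_LLc b h = bounding_number (LLc b h)"
  by (simp add: b_LLc_def bounding_number_def unbounded_def LLc_def case_prod_unfold)

lemma d_LLc_eq_dominating_number: "d_LLc b h = dominating_number (LLc b h)"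
  by (simp add: d_LLc_def dominating_number_def dominating_def LLc_def case_prod_unfold)

lemma unbounded_LLc_seqs:
  assumes "\<forall>n. h n < b n"
  shows "unbounded (LLc b h) (seqs b)"
  using b_LLc_nonempty[OF assms] by (simp add: unbounded_def LLc_def case_prod_unfold)

lemma dominating_LLc_slaloms:
  assumes "\<forall>n. 1 \<le> h n"
  shows "dominating (LLc b h) ({D. infinite D} \<times> slaloms b h)"
  using d_LLc_nonempty[OF assms] by (simp add: dominating_def LLc_def case_prod_unfold)

lemma Card_order_b_LLc: "\<forall>n. h n < b n \<Longrightarrow> Card_order (b_LLc b h)"
  unfolding b_LLc_eq_bounding_number
  by (rule Card_order_bounding_number[OF unbounded_LLc_seqs])

lemma Card_order_d_LLc: "\<forall>n. 1 \<le> h n \<Longrightarrow> Card_order (d_LLc b h)"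
  unfolding d_LLc_eq_dominating_number
  by (rule Card_order_dominating_number[OF dominating_LLc_slaloms])

definition push_slalom :: "('i \<Rightarrow> 'j) \<Rightarrow> ('i \<Rightarrow> 'a set) \<Rightarrow> 'j \<Rightarrow> 'a set" where
  "push_slalom a \<phi> m = (\<Union>n\<in>a -` {m}. \<phi> n)"

lemma push_slalom_in_slaloms:
  assumes "inj a" "\<forall>n. h' n \<le> h (a n)" "\<phi> \<in> slaloms (b \<circ> a) h'"
  shows "push_slalom a \<phi> \<in> slaloms b h"
proof -
  have "push_slalom a \<phi> m \<subseteq> {..<b m} \<and> card (push_slalom a \<phi> m) \<le> h m" for m
  proof (cases "m \<in> range a")
    case True
    then obtain n where m: "m = a n" by blast
    then have "push_slalom a \<phi> m = \<phi> n"
      using assms(1) by (auto simp: push_slalom_def dest: injD)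
    moreover have "\<phi> n \<subseteq> {..<b m}" "card (\<phi> n) \<le> h' n"
      using assms(3) m by (auto simp: slaloms_def)
    ultimately show ?thesis using assms(2) m le_trans by metis
  next
    case False
    then have "push_slalom a \<phi> m = {}" by (auto simp: push_slalom_def)
    then show ?thesis by simp
  qed
  then show ?thesis by (simp add: slaloms_def)
qed

lemma localized_on_push_slalom:
  assumes "localized_on D (x \<circ> a) \<phi>"
  shows "localized_on (a ` D) x (push_slalom a \<phi>)"
proof -
  have "{m \<in> a ` D. x m \<notin> push_slalom a \<phi> m} \<subseteq> a ` {n \<in> D. (x \<circ> a) n \<notin> \<phi> n}"
    by (auto simp: push_slalom_def)
  then show ?thesis
    using assms unfolding localized_on_def by (meson finite_imageI finite_subset)
qed

lemma tukey_connection_LLc_subseq: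
  assumes "inj a" "\<forall>n. h' n \<le> h (a n)"
  shows "tukey_connection (LLc b h) (LLc (b \<circ> a) h')
    (\<lambda>x. x \<circ> a) (map_prod (image a) (push_slalom a))"
proof -
  have "(\<lambda>x. x \<circ> a) \<in> seqs b \<rightarrow> seqs (b \<circ> a)"
    by (auto simp: seqs_def)
  moreover have "infinite (a ` D)" if "infinite D" for D
    using that assms(1) by (simp add: finite_image_iff inj_on_subset)
  then have "map_prod (image a) (push_slalom a)
      \<in> {D. infinite D} \<times> slaloms (b \<circ> a) h' \<rightarrow> {D. infinite D} \<times> slaloms b h"
    using push_slalom_in_slaloms[OF assms] by auto
  ultimately show ?thesis
    by (auto simp: tukey_connection_def LLc_def localized_on_push_slalom)
qed

lemma filterlim_at_top_dominating_subseq: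
  fixes f g :: "nat \<Rightarrow> 'a :: linorder"
  assumes "filterlim f at_top sequentially"
  obtains a where "strict_mono a" "\<forall>n. g n \<le> f (a n)"
proof -
  have "\<exists>m. g n \<le> f m \<and> k < m" for k n
  proof -
    have "eventually (\<lambda>m. g n \<le> f m \<and> k < m) sequentially"
      using assms by (simp add: filterlim_at_top eventually_conj_iff eventually_gt_at_top)
    then show ?thesis by (rule eventually_happens'[OF sequentially_bot])
  qed
  then have "\<exists>a. \<forall>n. g n \<le> f (a n) \<and> a n < a (Suc n)"
    by (intro dependent_nat_choice) blast+
  then show thesis using that by (auto simp: strict_mono_Suc_iff)
qed

lemma LLc_tukey_transfer:
  assumes "filterlim h at_top sequentially" "\<forall>n. h n < b n"
  obtains b' f g where "\<forall>n. h' n < b' n" "tukey_connection (LLc b h) (LLc b' h') f g"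
proof -
  obtain a where a: "strict_mono a" "\<forall>n. h' n \<le> h (a n)"
    using filterlim_at_top_dominating_subseq[OF assms(1)] .
  have "inj a" using a(1) by (rule strict_mono_imp_inj_on)
  moreover have "\<forall>n. h' n < (b \<circ> a) n"
    using a(2) assms(2) by (auto intro: le_less_trans)
  ultimately show thesis using that tukey_connection_LLc_subseq a(2) by blast
qed

lemma min_b_LLc_le:
  assumes "filterlim h at_top sequentially"
  shows "card_min {b_LLc b h' | b. \<forall>n. h' n < b n} \<le>o card_min {b_LLc b h | b. \<forall>n. h n < b n}"
proof (rule card_min_mono)
  show "{b_LLc b h | b. \<forall>n. h n < b n} \<noteq> {}"
    by (auto intro!: exI[of _ "\<lambda>n. Suc (h n)"])
  show "\<forall>r\<in>{b_LLc b h | b. \<forall>n. h n < b n}. \<exists>s\<in>{b_LLc b h' | b. \<forall>n. h' n < b n}. s \<le>o r"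
  proof clarify
    fix b assume b: "\<forall>n. h n < b n"
    obtain b' f g where b': "\<forall>n. h' n < b' n"
      and tukey: "tukey_connection (LLc b h) (LLc b' h') f g"
      using LLc_tukey_transfer[OF assms b] .
    have "b_LLc b' h' \<le>o b_LLc b h"
      unfolding b_LLc_eq_bounding_number using tukey unbounded_LLc_seqs[OF b]
      by (rule tukey_bounding_number_le)
    then show "\<exists>s\<in>{b_LLc b h' | b. \<forall>n. h' n < b n}. s \<le>o b_LLc b h"
      using b' by blast
  qed
qed (use Card_order_b_LLc in blast)+

lemma sup_d_LLc_le:
  assumes "filterlim h at_top sequentially" "\<forall>n. 1 \<le> h n" "\<forall>n. 1 \<le> h' n"
  shows "card_sup {d_LLc b h | b. \<forall>n. h n < b n} \<le>o card_sup {d_LLc b h' | b. \<forall>n. h' n < b n}"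
proof (rule card_sup_mono)
  show "\<forall>r\<in>{d_LLc b h | b. \<forall>n. h n < b n}. \<exists>s\<in>{d_LLc b h' | b. \<forall>n. h' n < b n}. r \<le>o s"
  proof clarify
    fix b assume b: "\<forall>n. h n < b n"
    obtain b' f g where b': "\<forall>n. h' n < b' n"
      and tukey: "tukey_connection (LLc b h) (LLc b' h') f g"
      using LLc_tukey_transfer[OF assms(1) b] .
    have "d_LLc b h \<le>o d_LLc b' h'"
      unfolding d_LLc_eq_dominating_number using tukey dominating_LLc_slaloms[OF assms(3)]
      by (rule tukey_dominating_number_le)
    then show "\<exists>s\<in>{d_LLc b h' | b. \<forall>n. h' n < b n}. d_LLc b h \<le>o s"
      using b' by blast
  qed
qed (use Card_order_d_LLc assms(2,3) in blast)+

theorem theorem2p8: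
  fixes h h' :: "nat \<Rightarrow> nat"
  assumes "\<forall>n. 1 \<le> h n" and "filterlim h at_top sequentially"
    and "\<forall>n. 1 \<le> h' n" and "filterlim h' at_top sequentially"
  shows "card_min {b_LLc b h | b. \<forall>n. h n < b n} =o card_min {b_LLc b h' | b. \<forall>n. h' n < b n}
    \<and> card_sup {d_LLc b h | b. \<forall>n. h n < b n} =o card_sup {d_LLc b h' | b. \<forall>n. h' n < b n}"
  unfolding ordIso_iff_ordLeq
proof (intro conjI)
  show "card_min {b_LLc b h | b. \<forall>n. h n < b n} \<le>o card_min {b_LLc b h' | b. \<forall>n. h' n < b n}"
    using assms(4) by (rule min_b_LLc_le)
  show "card_min {b_LLc b h' | b. \<forall>n. h' n < b n} \<le>o card_min {b_LLc b h | b. \<forall>n. h n < b n}"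
    using assms(2) by (rule min_b_LLc_le)
  show "card_sup {d_LLc b h | b. \<forall>n. h n < b n} \<le>o card_sup {d_LLc b h' | b. \<forall>n. h' n < b n}"
    using assms(2,1,3) by (rule sup_d_LLc_le)
  show "card_sup {d_LLc b h' | b. \<forall>n. h' n < b n} \<le>o card_sup {d_LLc b h | b. \<forall>n. h n < b n}"
    using assms(4,3,1) by (rule sup_d_LLc_le)
qed

end
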